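(* Let \[I_{x,y}(w,0)=\sum_{n\ge 0}\sum_{\sigma\in\mathcal W_2(n)}w^n x^{\operatorname{des}(\sigma)+1}y^{\operatorname{peak}(\sigma)+1}.\] Then $R(I_{x,y}(w,0),w,x,y)=0$, where \[\begin{aligned}R(v,w,x,y)=\;&-x+(4x+8x^2-xy)w+(-6x-16x^2-16x^3+3xy+36x^2y)w^2\\&+(4x+8x^2-3xy-36x^2y+27x^2y^2)w^3+(-x+xy)w^4\\ &+\big(1+(-4-12x)w+(6+20x+32x^2-33xy)w^2+(-4-4x+16x^2+30xy-36x^2y)w^3+(1-4x+3xy)w^4\big)v\\ &+\big(4w+(-4-22x)w^2+(-4-20x+8x^2+33xy)w^3+(4-6x+3xy)w^4\big)v^2\\ &+\big(6w^2+(4-12x)w^3+(6-4x+xy)w^4\big)v^3+\big(4w^3+(4-x)w^4\big)v^4+w^4v^5.\end{aligned}\]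
   Context: $S_n$ is the set of permutations of $\{1,\dots,n\}$ in one-line notation. For $\pi=\pi_1\cdots\pi_n$, $\operatorname{des}(\pi)$ is the number of $i\in[n-1]$ with $\pi_i>\pi_{i+1}$ and $\operatorname{peak}(\pi)$ is the number of $i\in\{2,\dots,n-1\}$ with $\pi_{i-1}<\pi_i>\pi_{i+1}$. Convention: the empty permutation (the unique element of $S_0$) has $0$ descents and $-1$ peaks, so it contributes $x$ to the $w^0$ term. The stack-sorting map $s$: given an input permutation, repeatedly: if the stack is empty or the next input entry is smaller than the top of the stack, push the next input entry; otherwise pop the top of the stack to the end of the output. $s(\pi)$ is the final output. A permutation $\pi$ is $t$-stack-sortable if $s^t(\pi)$ (the $t$-fold iterate) is increasing. $\mathcal W_t(n)$ is the set of $t$-stack-sortable permutations in $S_n$. *)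

theory Defs
  imports
    "HOL-Computational_Algebra.Computational_Algebra"
    "HOL-Combinatorics.Multiset_Permutations"
begin

text \<open>
  A permutation of \<open>{1,...,n}\<close> in one-line notation is a list in
  \<^term>\<open>permutations_of_set {1..n}\<close>. List positions count from 0, so the entry
  in position \<open>i\<close> of the one-line notation is \<open>p ! (i - 1)\<close>.
\<close>

definition des :: "nat list \<Rightarrow> nat" where
  "des p = card {i. i + 1 < length p \<and> p ! i > p ! (i + 1)}"

text \<open>Integer-valued, since the empty permutation has \<open>-1\<close> peaks by convention.\<close>

definition peak :: "nat list \<Rightarrow> int" where
  "peak p = (if p = [] then - 1
     else int (card {i. i + 2 < length p \<and> p ! i < p ! (i + 1) \<and> p ! (i + 1) > p ! (i + 2)}))"

text \<open>
  \<open>stack_run st inp\<close> is the output still to be produced when the stack, listed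
  from its top, is \<open>st\<close> and the unread input is \<open>inp\<close>; a popped entry
  therefore precedes everything that is output later. Once the input is exhausted,
  the stack is emptied.
\<close>

fun stack_run :: "nat list \<Rightarrow> nat list \<Rightarrow> nat list" where
  "stack_run [] [] = []"
| "stack_run [] (a # inp) = stack_run [a] inp"
| "stack_run (t # st) [] = t # stack_run st []"
| "stack_run (t # st) (a # inp) =
     (if a < t then stack_run (a # t # st) inp else t # stack_run st (a # inp))"

definition stack_sort :: "nat list \<Rightarrow> nat list" where
  "stack_sort p = stack_run [] p"

definition stack_sortable :: "nat \<Rightarrow> nat list \<Rightarrow> bool" where
  "stack_sortable t p \<longleftrightarrow> sorted_wrt (<) ((stack_sort ^^ t) p)"

definition W :: "nat \<Rightarrow> nat \<Rightarrow> nat list set" where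
  "W t n = {p \<in> permutations_of_set {1..n}. stack_sortable t p}"

text \<open>The power series variable \<open>w\<close> is \<^term>\<open>fps_X\<close>; the conversion to
  \<^typ>\<open>nat\<close> is exact because \<open>peak \<sigma> + 1\<close> is never negative.\<close>

definition I_gf :: "'a::comm_ring_1 \<Rightarrow> 'a \<Rightarrow> 'a fps" where
  "I_gf x y = Abs_fps (\<lambda>n. \<Sum>\<sigma>\<in>W 2 n. x ^ (des \<sigma> + 1) * y ^ nat (peak \<sigma> + 1))"

text \<open>The two indeterminates of \<open>\<int>[x,y]\<close>, realised as \<open>\<int>[x][y]\<close>.\<close>

definition X_var :: "int poly poly" where
  "X_var = [:[:0, 1:]:]"

definition Y_var :: "int poly poly" where
  "Y_var = [:0, 1:]"

definition R :: "'a::comm_ring_1 \<Rightarrow> 'a \<Rightarrow> 'a \<Rightarrow> 'a \<Rightarrow> 'a" where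
  "R v w x y =
     - x + (4*x + 8*x^2 - x*y)*w + (- 6*x - 16*x^2 - 16*x^3 + 3*x*y + 36*x^2*y)*w^2
     + (4*x + 8*x^2 - 3*x*y - 36*x^2*y + 27*x^2*y^2)*w^3 + (- x + x*y)*w^4
     + (1 + (- 4 - 12*x)*w + (6 + 20*x + 32*x^2 - 33*x*y)*w^2
        + (- 4 - 4*x + 16*x^2 + 30*x*y - 36*x^2*y)*w^3 + (1 - 4*x + 3*x*y)*w^4)*v
     + (4*w + (- 4 - 22*x)*w^2 + (- 4 - 20*x + 8*x^2 + 33*x*y)*w^3
        + (4 - 6*x + 3*x*y)*w^4)*v^2
     + (6*w^2 + (4 - 12*x)*w^3 + (6 - 4*x + x*y)*w^4)*v^3
     + (4*w^3 + (4 - x)*w^4)*v^4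
     + w^4*v^5"

end

theory Submission imports Defs begin

text \<open>
  Stack sorting a word \<open>l m r\<close> with maximum \<open>m\<close> gives the sorted \<open>l\<close>, the sorted \<open>r\<close>, then \<open>m\<close>. Hence
  the concatenation of the sorted words of a list (a forest) is sorted by one more pass iff, after
  removal of its maximum \<open>m\<close>, the part consisting of the words before \<open>l m r\<close> followed by \<open>l\<close> and \<open>r\<close>
  and the part consisting of the words after it both have this property and the first part is below
  the second. When \<open>u\<close> marks the number of nonempty words of a forest, \<open>f\<close> is the coefficient of \<open>u\<close>
  in the generating function \<open>F\<close>, and \<open>peak + 1\<close> counts the leaves of the decreasing tree of a word,
  this reads
  \<open>u (F - 1) = w F (y u\<^sup>2 F + (1 + x) u (F - 1) + x (F - 1 - u f))\<close>.
  Completing the square shows that a cubic polynomial in \<open>u\<close> is the square of a series \<open>G\<close>. So \<open>G\<close> divides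
  the cubic, its derivative in \<open>u\<close>, and the discriminant, which is free of \<open>u\<close>. As \<open>G = - u\<close>
  at \<open>w = 0\<close>, this forces the discriminant to vanish, and it is \<open>R\<close> up to a monomial factor.
\<close>

section \<open>Stack sorting and the maximal entry\<close>

lemma mset_stack_run: "mset (stack_run st inp) = mset st + mset inp"
  by (induction st inp rule: stack_run.induct) auto

lemma set_stack_sort [simp]: "set (stack_sort p) = set p"
  using mset_stack_run[of "[]" p] unfolding stack_sort_def by (metis add_0 mset.simps(1) set_mset_mset)

lemma stack_sort_Nil [simp]: "stack_sort [] = []"
  by (simp add: stack_sort_def)

text \<open>Entries smaller than \<open>m\<close> are always pushed above it, so \<open>m\<close>
  leaves the stack only after the input is exhausted.\<close>

lemma stack_run_bottom:
  "\<forall>a\<in>set inp. a < m \<Longrightarrow> stack_run (st @ [m]) inp = stack_run st inp @ [m]"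
  by (induction st inp rule: stack_run.induct) auto

text \<open>Reading \<open>m\<close> pops the whole stack, because every entry on it is smaller; the
  run then continues from the stack \<open>[m]\<close>.\<close>

lemma stack_run_split:
  "\<forall>a\<in>set st \<union> set l. a < m \<Longrightarrow> stack_run st (l @ m # r) = stack_run st l @ stack_run [m] r"
  by (induction st l rule: stack_run.induct) auto

lemma stack_sort_max:
  assumes "\<forall>a\<in>set l \<union> set r. a < m"
  shows "stack_sort (l @ m # r) = stack_sort l @ stack_sort r @ [m]"
  using stack_run_split[of "[]" l m r] stack_run_bottom[of r m "[]"] assms
  by (simp add: stack_sort_def)

lemma stack_sort_max_sorted_iff:
  assumes "\<forall>a\<in>set l \<union> set r. a < m"
  shows "sorted_wrt (<) (stack_sort (l @ m # r)) \<longleftrightarrow>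
    sorted_wrt (<) (stack_sort l) \<and> sorted_wrt (<) (stack_sort r) \<and> (\<forall>a\<in>set l. \<forall>b\<in>set r. a < b)"
  using assms by (auto simp: stack_sort_max sorted_wrt_append)

section \<open>Descents and peaks of a word split at its maximum\<close>

lemma card_Suc_vimage:
  assumes "\<And>i. Suc i \<in> A \<longleftrightarrow> i \<in> B" "finite (B :: nat set)"
  shows "card A = of_bool (0 \<in> A) + card B"
proof -
  have A: "A = (if 0 \<in> A then insert 0 (Suc ` B) else Suc ` B)"
    using assms(1) by (auto simp: image_iff) (metis not0_implies_Suc)+
  have "card (Suc ` B) = card B" by (simp add: card_image)
  then show ?thesis using assms(2) by (subst A) auto
qed

lemma des_Nil [simp]: "des [] = 0" and des_single [simp]: "des [a] = 0"
  by (auto simp: des_def)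

lemma des_Cons [simp]: "des (a # b # p) = of_bool (b < a) + des (b # p)"
  unfolding des_def by (subst card_Suc_vimage[where B = "{i. i + 1 < length (b # p) \<and> (b # p) ! i > (b # p) ! (i + 1)}"])
    auto

lemma peak_Nil [simp]: "peak [] = -1" and peak_single [simp]: "peak [a] = 0"
  and peak_pair [simp]: "peak [a, b] = 0"
  by (auto simp: peak_def)

lemma peak_Cons [simp]:
  "peak (a # b # c # p) = of_bool (a < b \<and> c < b) + peak (b # c # p)"
  unfolding peak_def
  by (subst card_Suc_vimage[where B = "{i. i + 2 < length (b # c # p) \<and> (b # c # p) ! i < (b # c # p) ! (i + 1)
      \<and> (b # c # p) ! (i + 1) > (b # c # p) ! (i + 2)}"]) auto

lemma peak_ge: "peak p \<ge> -1"
  by (auto simp: peak_def)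

text \<open>No descent enters \<open>m\<close>, and \<open>m\<close> starts one exactly when
  something follows it.\<close>

lemma des_max:
  assumes "\<forall>a\<in>set l \<union> set r. a < m"
  shows "des (l @ m # r) = des l + des r + of_bool (r \<noteq> [])"
  using assms
proof (induction l rule: induct_list012)
  case 1
  then show ?case by (cases r) auto
next
  case (2 a)
  then show ?case by (cases r) auto
qed auto

text \<open>Adding 1 to each \<open>peak\<close> gives the leaf count of the decreasing tree: the
  leaves of both subtrees, plus one if \<open>m\<close> itself is a leaf. The value -1 for the empty
  word makes an empty subtree count 0 leaves.\<close>

lemma peak_max:
  assumes "\<forall>a\<in>set l \<union> set r. a < m"
  shows "peak (l @ m # r) = peak l + peak r + 1 + of_bool (l = [] \<and> r = [])"
  using assms
proof (induction l rule: induct_list012)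
  case 1
  then show ?case
  \<comment> \<open>\<open>remdups_adj.cases\<close> serves only as a split into lists of length 0,
    1 and at least 2.\<close>
  proof (cases r rule: remdups_adj.cases)
    case (3 b c q)
    then show ?thesis using 1 by auto
  qed auto
next
  case (2 a)
  then show ?case
  proof (cases r rule: remdups_adj.cases)
    case (3 b c q)
    then show ?thesis using 2 by auto
  qed auto
next
  case (3 a b l)
  then show ?case by (cases l) auto
qed

section \<open>Forests\<close>

text \<open>A word stands for its decreasing binary tree, which stack sorting reads in postorder.\<close>

definition arrangements :: "nat set \<Rightarrow> nat list list set" where
  "arrangements S = {ws. distinct (concat ws) \<and> set (concat ws) = S \<and>
     sorted_wrt (<) (stack_sort (concat (map stack_sort ws)))}"

text \<open>Empty words stay legal in \<open>arrangements\<close> because a root may lack a subtree;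
  counting needs them excluded, since they could be inserted without limit.\<close>

definition forests :: "nat set \<Rightarrow> nat list list set" where
  "forests S = {ws \<in> arrangements S. [] \<notin> set ws}"

text \<open>What remains of the part of a forest up to the tree of the maximum once that root is
  deleted: the earlier trees and the two subtrees, either of which may be empty.\<close>

definition cuts :: "nat set \<Rightarrow> (nat list list \<times> nat list \<times> nat list) set" where
  "cuts S = {(ws, l, r). ws @ [l, r] \<in> arrangements S \<and> [] \<notin> set ws}"

lemma set_concat_stack_sort [simp]: "set (concat (map stack_sort ws)) = set (concat ws)"
  by auto

text \<open>Makes both parts of a decomposition intervals again, so that each is a smaller instance
  of the same problem.\<close>

lemma interval_split:
  fixes a n :: nat
  assumes "A \<union> B = {a..<a + n}" "\<forall>i\<in>A. \<forall>j\<in>B. i < j"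
  obtains b where "b \<le> n" "A = {a..<a + b}" "B = {a + b..<a + n}"
proof (cases "B = {}")
  case True
  then show ?thesis using assms(1) by (intro that[of n]) auto
next
  case False
  define c where "c = Inf B"
  have c: "c \<in> B" "\<And>j. j \<in> B \<Longrightarrow> c \<le> j"
    using False by (auto simp: c_def Inf_nat_def1 cInf_lower)
  have ca: "a \<le> c" "c < a + n" using c assms(1) by auto
  have AB: "i \<in> A \<or> i \<in> B \<longleftrightarrow> a \<le> i \<and> i < a + n" for i
    unfolding Un_iff[symmetric] assms(1) by simp
  have A: "i < c" if "i \<in> A" for i using assms(2) c(1) that by blast
  have "A = {a..<c}"
  proof (intro set_eqI iffI)
    fix i assume "i \<in> A"
    then show "i \<in> {a..<c}" using AB[of i] A[of i] by simp
  next
    fix i assume "i \<in> {a..<c}"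
    then have "\<not> c \<le> i" "i \<in> A \<or> i \<in> B" using AB[of i] ca by simp_all
    then show "i \<in> A" using c(2)[of i] by blast
  qed
  moreover have "B = {c..<a + n}"
  proof (intro set_eqI iffI)
    fix i assume "i \<in> B"
    then show "i \<in> {c..<a + n}" using AB[of i] c(2)[of i] by simp
  next
    fix i assume "i \<in> {c..<a + n}"
    then have "\<not> i < c" "i \<in> A \<or> i \<in> B" using AB[of i] ca by simp_all
    then show "i \<in> B" using A[of i] by blast
  qed
  ultimately show ?thesis using ca by (intro that[of "c - a"]) auto
qed

text \<open>The first pass moves the maximum \<open>m\<close> behind the sorted \<open>l\<close> and
  \<open>r\<close>, so the second pass reads \<open>U @ m # V\<close>, with \<open>U\<close> from
  \<open>ws\<close>, \<open>l\<close>, \<open>r\<close> and \<open>V\<close> from \<open>vs\<close>.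
  It succeeds iff it succeeds on \<open>U\<close> and on \<open>V\<close> and \<open>U\<close> lies
  below \<open>V\<close>, which forces consecutive intervals of entries.\<close>

lemma arrangements_max:
  "ws @ (l @ (a + n) # r) # vs \<in> arrangements {a..<a + Suc n} \<longleftrightarrow>
    (\<exists>b\<le>n. ws @ [l, r] \<in> arrangements {a..<a + b} \<and> vs \<in> arrangements {a + b..<a + n})"
    (is "?L \<longleftrightarrow> ?R")
proof -
  define m where "m = a + n"
  define U where "U = concat (map stack_sort (ws @ [l, r]))"
  define V where "V = concat (map stack_sort vs)"
  have U: "set U = set (concat (ws @ [l, r]))" and V: "set V = set (concat vs)"
    unfolding U_def V_def by (rule set_concat_stack_sort)+
  have ins: "{a..<a + Suc n} = insert m {a..<m}" and fresh: "m \<notin> {a..<m}"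
    by (auto simp: m_def)
  have cat: "concat (map stack_sort (ws @ (l @ m # r) # vs)) = U @ m # V"
    if "\<forall>i\<in>set l \<union> set r. i < m"
    using that by (simp add: U_def V_def stack_sort_max)
  have "?L \<longleftrightarrow> distinct (concat (ws @ [l, r])) \<and> distinct (concat vs) \<and> set U \<inter> set V = {} \<and>
      set U \<union> set V = {a..<m} \<and> sorted_wrt (<) (stack_sort (concat (map stack_sort (ws @ (l @ m # r) # vs))))"
    unfolding arrangements_def ins U V m_def[symmetric] using fresh by auto
  also have "\<dots> \<longleftrightarrow> distinct (concat (ws @ [l, r])) \<and> distinct (concat vs) \<and>
      set U \<union> set V = {a..<m} \<and> sorted_wrt (<) (stack_sort U) \<and> sorted_wrt (<) (stack_sort V) \<and>
      (\<forall>i\<in>set U. \<forall>j\<in>set V. i < j)"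
  \<comment> \<open>This equation is a conjunct on both sides; when it holds, \<open>m\<close>
    exceeds all other entries and \<open>cat\<close> applies.\<close>
  proof (cases "set U \<union> set V = {a..<m}")
    case True
    then have lt: "\<forall>i\<in>set U \<union> set V. i < m" by auto
    then have "\<forall>i\<in>set l \<union> set r. i < m" using U by auto
    from cat[OF this] stack_sort_max_sorted_iff[OF lt] True show ?thesis
      by auto
  qed auto
  also have "\<dots> \<longleftrightarrow> ?R"
  proof
    assume *: "distinct (concat (ws @ [l, r])) \<and> distinct (concat vs) \<and>
      set U \<union> set V = {a..<m} \<and> sorted_wrt (<) (stack_sort U) \<and> sorted_wrt (<) (stack_sort V) \<and>
      (\<forall>i\<in>set U. \<forall>j\<in>set V. i < j)"
    then obtain b where b: "b \<le> n" "set U = {a..<a + b}" "set V = {a + b..<a + n}"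
      using interval_split[of "set U" "set V" a n] unfolding m_def by metis
    have "ws @ [l, r] \<in> arrangements {a..<a + b}" "vs \<in> arrangements {a + b..<a + n}"
      unfolding arrangements_def mem_Collect_eq U_def[symmetric] V_def[symmetric]
      using * b U V by blast+
    then show ?R using b(1) by blast
  next
    assume ?R
    then obtain b where b: "b \<le> n" "ws @ [l, r] \<in> arrangements {a..<a + b}"
      "vs \<in> arrangements {a + b..<a + n}" by blast
    have s: "set U = {a..<a + b}" "set V = {a + b..<a + n}"
      using b U V unfolding arrangements_def by auto
    have "set U \<union> set V = {a..<m}" using s b(1) by (auto simp: m_def)
    moreover have "\<forall>i\<in>set U. \<forall>j\<in>set V. i < j" using s by auto
    ultimately show "distinct (concat (ws @ [l, r])) \<and> distinct (concat vs) \<and>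
      set U \<union> set V = {a..<m} \<and> sorted_wrt (<) (stack_sort U) \<and> sorted_wrt (<) (stack_sort V) \<and>
      (\<forall>i\<in>set U. \<forall>j\<in>set V. i < j)"
      using b unfolding arrangements_def U_def V_def by blast
  qed
  finally show ?thesis .
qed

section \<open>Finiteness of forests and the four shapes of a cut\<close>

lemma length_le_length_concat: "[] \<notin> set ws \<Longrightarrow> length ws \<le> length (concat ws)"
proof (induction ws)
  case (Cons w ws)
  then show ?case by (cases w) auto
qed simp

text \<open>Entries are distinct, so \<open>card S\<close> bounds the length of each word and, the
  words being nonempty, also their number.\<close>

lemma finite_forests:
  assumes "finite S"
  shows "finite (forests S)"
proof (rule finite_subset)
  define T where "T = {w. set w \<subseteq> S \<and> length w \<le> card S}"
  show "finite {ws. set ws \<subseteq> T \<and> length ws \<le> card S}"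
    unfolding T_def by (intro finite_lists_length_le assms)
  show "forests S \<subseteq> {ws. set ws \<subseteq> T \<and> length ws \<le> card S}"
  proof
    fix ws assume ws: "ws \<in> forests S"
    then have *: "distinct (concat ws)" "set (concat ws) = S" "[] \<notin> set ws"
      by (auto simp: forests_def arrangements_def)
    have len: "length (concat ws) = card S" using * distinct_card by metis
    have "w \<in> T" if w: "w \<in> set ws" for w
    proof -
      have "distinct w" using *(1) w by (auto simp: distinct_concat_iff)
      moreover have "set w \<subseteq> S" using w *(2) by auto
      ultimately show ?thesis
        using card_mono[OF assms] by (simp add: T_def flip: distinct_card)
    qed
    then show "ws \<in> {ws. set ws \<subseteq> T \<and> length ws \<le> card S}"
      using length_le_length_concat[OF *(3)] len by auto
  qed
qed

lemma arrangements_Nil: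
  "us @ [] # vs \<in> arrangements S \<longleftrightarrow> us @ vs \<in> arrangements S"
  by (simp add: arrangements_def)

lemma butlast_last_inject:
  "butlast us = butlast vs \<Longrightarrow> last us = last vs \<Longrightarrow> us \<noteq> [] \<Longrightarrow> vs \<noteq> [] \<Longrightarrow> us = vs"
  by (metis append_butlast_last_id)

lemma append_butlast_last2:
  assumes "2 \<le> length ws"
  shows "butlast (butlast ws) @ [last (butlast ws), last ws] = ws"
proof -
  have "butlast ws \<noteq> []" "ws \<noteq> []" using assms by (auto simp flip: length_greater_0_conv)
  then show ?thesis using append_butlast_last_id[of "butlast ws"] append_butlast_last_id[of ws]
    by (metis append.assoc append_Cons append_Nil)
qed

text \<open>Dropping the empty subtrees turns a cut into a forest. The four images say which
  subtrees the deleted root had: none, left only, right only, both.\<close>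

lemma cuts_eq:
  "cuts S = (\<lambda>ws. (ws, [], [])) ` forests S
    \<union> (\<lambda>ws. (butlast ws, last ws, [])) ` {ws \<in> forests S. ws \<noteq> []}
    \<union> (\<lambda>ws. (butlast ws, [], last ws)) ` {ws \<in> forests S. ws \<noteq> []}
    \<union> (\<lambda>ws. (butlast (butlast ws), last (butlast ws), last ws)) ` {ws \<in> forests S. 2 \<le> length ws}"
    (is "_ = ?A \<union> ?B \<union> ?C \<union> ?D")
proof (intro equalityI subsetI)
  fix t assume "t \<in> cuts S"
  then obtain ws l r where t: "t = (ws, l, r)" "ws @ [l, r] \<in> arrangements S" "[] \<notin> set ws"
    by (auto simp: cuts_def)
  note Nil = arrangements_Nil[of ws "[r]"] arrangements_Nil[of "ws @ [l]" "[]"] arrangements_Nil[of ws "[]"]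
  show "t \<in> ?A \<union> ?B \<union> ?C \<union> ?D"
  proof (cases "l = []"; cases "r = []")
    assume "l = []" "r = []"
    then have "t \<in> ?A" using t Nil by (auto simp: forests_def)
    then show ?thesis by blast
  next
    assume *: "l = []" "r \<noteq> []"
    then have "t \<in> ?C" using t Nil by (auto simp: forests_def intro!: image_eqI[of _ _ "ws @ [r]"])
    then show ?thesis by blast
  next
    assume *: "l \<noteq> []" "r = []"
    then have "t \<in> ?B" using t Nil by (auto simp: forests_def intro!: image_eqI[of _ _ "ws @ [l]"])
    then show ?thesis by blast
  next
    assume *: "l \<noteq> []" "r \<noteq> []"
    then have "t \<in> ?D"
      using t by (auto simp: forests_def butlast_append intro!: image_eqI[of _ _ "ws @ [l, r]"])
    then show ?thesis by blast
  qed
next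
  fix t assume "t \<in> ?A \<union> ?B \<union> ?C \<union> ?D"
  then consider "t \<in> ?A" | "t \<in> ?B" | "t \<in> ?C" | "t \<in> ?D" by blast
  then show "t \<in> cuts S"
  proof cases
    case 1
    then show ?thesis
      using arrangements_Nil[of _ "[[]]"] arrangements_Nil[of _ "[]"] by (auto simp: cuts_def forests_def)
  next
    case 2
    then obtain ws where t: "t = (butlast ws, last ws, [])" and ws: "ws \<in> forests S" "ws \<noteq> []" by blast
    have "butlast ws @ [last ws, []] = (butlast ws @ [last ws]) @ [] # []" by simp
    also have "\<dots> \<in> arrangements S" using ws arrangements_Nil[of ws "[]"] by (simp add: forests_def)
    finally show ?thesis using t ws by (auto simp: cuts_def forests_def dest: in_set_butlastD)
  next
    case 3
    then obtain ws where "t = (butlast ws, [], last ws)" "ws \<in> forests S" "ws \<noteq> []" by blast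
    then show ?thesis
      using arrangements_Nil[of "butlast ws" "[last ws]" S] append_butlast_last_id[of ws]
      by (auto simp: cuts_def forests_def dest: in_set_butlastD)
  next
    case 4
    then obtain ws where t: "t = (butlast (butlast ws), last (butlast ws), last ws)"
      and ws: "ws \<in> forests S" "2 \<le> length ws" by blast
    have "butlast ws \<noteq> []" "[] \<notin> set (butlast (butlast ws))"
      using ws by (auto simp: forests_def dest!: in_set_butlastD simp flip: length_greater_0_conv)
    then show ?thesis using t ws append_butlast_last2[OF ws(2)] by (auto simp: cuts_def forests_def)
  qed
qed

section \<open>Elimination of the catalytic variable\<close>

text \<open>Here \<open>e u + h\<close> is the remainder of \<open>9 p\<^sub>3 D\<close> modulo the derivative \<open>D'\<close> of \<open>D\<close>.\<close>

lemma cubic_discriminant_combination: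
  fixes u p\<^sub>0 p\<^sub>1 p\<^sub>2 p\<^sub>3 :: "'b::idom"
  defines "D \<equiv> p\<^sub>3 * u ^ 3 + p\<^sub>2 * u ^ 2 + p\<^sub>1 * u + p\<^sub>0"
    and "D' \<equiv> 3 * p\<^sub>3 * u ^ 2 + 2 * p\<^sub>2 * u + p\<^sub>1"
    and "e \<equiv> 6 * p\<^sub>3 * p\<^sub>1 - 2 * p\<^sub>2 ^ 2" and "h \<equiv> 9 * p\<^sub>3 * p\<^sub>0 - p\<^sub>2 * p\<^sub>1"
  shows "- 9 * p\<^sub>3 * (18 * p\<^sub>3 * p\<^sub>2 * p\<^sub>1 * p\<^sub>0 - 4 * p\<^sub>2 ^ 3 * p\<^sub>0 + p\<^sub>2 ^ 2 * p\<^sub>1 ^ 2 - 4 * p\<^sub>3 * p\<^sub>1 ^ 3 - 27 * p\<^sub>3 ^ 2 * p\<^sub>0 ^ 2)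
    = e ^ 2 * D' - (3 * p\<^sub>3 * (e * u - h) + 2 * p\<^sub>2 * e) * (9 * p\<^sub>3 * D - (3 * p\<^sub>3 * u + p\<^sub>2) * D')"
  \<comment> \<open>This is Euclid's algorithm: the last factor is the remainder
    \<open>e * u + h\<close>, and dividing \<open>e ^ 2 * D'\<close> by it leaves a remainder free
    of \<open>u\<close>.\<close>
  unfolding assms by algebra

text \<open>The coefficients are those of \<open>(w * x + u * c) ^ 2 - 4 * w * u * (x + (1 + x) * u
  + y * u ^ 2)\<close> as a cubic in \<open>u\<close>, the discriminant of the quadratic equation
  for the forest series. Its own discriminant is \<open>- 16 * w ^ 3 * x ^ 2 * R v w x y\<close>;
  the factor \<open>- 9 * p\<^sub>3\<close> comes from the elimination.\<close>

lemma discriminant_R: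
  fixes v w x y :: "'b::idom"
  defines "c \<equiv> 1 + w + w * v"
  defines "p\<^sub>3 \<equiv> - 4 * w * y" and "p\<^sub>2 \<equiv> c ^ 2 - 4 * w * (1 + x)" and "p\<^sub>1 \<equiv> 2 * w * x * (c - 2)"
    and "p\<^sub>0 \<equiv> (w * x) ^ 2"
  shows "- 9 * p\<^sub>3 * (18 * p\<^sub>3 * p\<^sub>2 * p\<^sub>1 * p\<^sub>0 - 4 * p\<^sub>2 ^ 3 * p\<^sub>0 + p\<^sub>2 ^ 2 * p\<^sub>1 ^ 2 - 4 * p\<^sub>3 * p\<^sub>1 ^ 3 - 27 * p\<^sub>3 ^ 2 * p\<^sub>0 ^ 2)
    = - 576 * w ^ 4 * x ^ 2 * y * R v w x y"
  unfolding assms R_def by algebra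

section \<open>Series over polynomials in the catalytic variable, and the series free of it\<close>

definition embed :: "'a::comm_ring_1 fps \<Rightarrow> 'a poly fps" where
  "embed f = Abs_fps (\<lambda>n. [:f $ n:])"

lemma embed_nth [simp]: "embed f $ n = [:f $ n:]"
  by (simp add: embed_def)

lemma smult_sum_right: "smult c (\<Sum>i\<in>A. f i) = (\<Sum>i\<in>A. smult c (f i :: 'b::comm_ring_1 poly))"
  by (induction A rule: infinite_finite_induct) (simp_all add: smult_add_right)

lemma sum_const_poly: "(\<Sum>i\<in>A. [:f i:]) = [:\<Sum>i\<in>A. f i:]"
  by (induction A rule: infinite_finite_induct) auto

lemma embed_const [simp]: "embed (fps_const c) = fps_const [:c:]"
  by (auto simp: fps_eq_iff)

lemma embed_1 [simp]: "embed 1 = 1"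
  by (auto simp: fps_eq_iff one_pCons)

lemma embed_numeral [simp]: "embed (numeral k) = numeral k"
  by (simp add: fps_eq_iff fps_numeral_nth numeral_poly)

lemma embed_X [simp]: "embed fps_X = fps_X"
  by (auto simp: fps_eq_iff fps_X_def one_pCons)

lemma embed_add [simp]: "embed (f + g) = embed f + embed g"
  by (simp add: fps_eq_iff)

lemma embed_diff [simp]: "embed (f - g) = embed f - embed g"
  by (simp add: fps_eq_iff)

lemma embed_minus [simp]: "embed (- f) = - embed f"
  by (simp add: fps_eq_iff)

lemma embed_mult [simp]: "embed (f * g) = embed f * embed g"
  by (simp add: fps_eq_iff fps_mult_nth sum_const_poly mult.commute)

lemma embed_power [simp]: "embed (f ^ n) = embed f ^ n"
  by (induction n) simp_all

lemma embed_R: "embed (R v w x y) = R (embed v) (embed w) (embed x) (embed y)"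
  unfolding R_def by simp

text \<open>The derivative in the catalytic variable, not in the series variable; images of
  \<open>embed\<close> are its constants.\<close>

definition pderiv_fps :: "'a::idom poly fps \<Rightarrow> 'a poly fps" where
  "pderiv_fps f = Abs_fps (\<lambda>n. pderiv (f $ n))"

lemma pderiv_fps_nth [simp]: "pderiv_fps f $ n = pderiv (f $ n)"
  by (simp add: pderiv_fps_def)

lemma pderiv_fps_add [simp]: "pderiv_fps (f + g) = pderiv_fps f + pderiv_fps g"
  by (simp add: fps_eq_iff pderiv_add)

lemma pderiv_sum: "pderiv (\<Sum>i\<in>A. f i) = (\<Sum>i\<in>A. pderiv (f i :: 'a::idom poly))"
  by (induction A rule: infinite_finite_induct) (simp_all add: pderiv_add)

lemma pderiv_fps_mult [simp]: "pderiv_fps (f * g) = f * pderiv_fps g + pderiv_fps f * g"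
  by (simp add: fps_eq_iff fps_mult_nth pderiv_sum pderiv_mult sum.distrib) (simp add: mult.commute)

lemma pderiv_fps_embed [simp]: "pderiv_fps (embed f) = 0"
  by (simp add: fps_eq_iff)

text \<open>The divisor is minus the polynomial variable plus a multiple of the series variable, so the
  lowest coefficient of a nonzero multiple of it involves the polynomial variable.\<close>

lemma embed_multiple_eq_0:
  fixes G :: "'a::idom poly fps"
  assumes dvd: "G dvd embed r" and G0: "G $ 0 = - monom 1 1"
  shows "r = 0"
proof -
  obtain H where H: "embed r = G * H" using dvd by (elim dvdE)
  have *: "r $ n = 0 \<and> H $ n = 0" for n
  proof (induction n rule: less_induct)
    case (less n)
    have "[:r $ n:] = (G * H) $ n" by (simp flip: H)
    also have "\<dots> = (\<Sum>i=0..n. G $ i * H $ (n - i))" by (rule fps_mult_nth)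
    \<comment> \<open>By induction the lower coefficients of \<open>H\<close> vanish, so only the
      lowest coefficient of \<open>G\<close> contributes.\<close>
    also have "\<dots> = (\<Sum>i\<in>{0}. G $ i * H $ (n - i))"
      using less by (intro sum.mono_neutral_right) auto
    finally have eq: "[:r $ n:] = - monom 1 1 * H $ n" by (simp add: G0)
    \<comment> \<open>A constant that is a multiple of the polynomial variable is zero.\<close>
    have "coeff [:r $ n:] 0 = 0" unfolding eq by (simp add: coeff_mult)
    then have "r $ n = 0" by simp
    moreover from this have "H $ n = 0" using eq by (simp add: monom_eq_0_iff)
    ultimately show ?case by blast
  qed
  show ?thesis by (rule fps_ext) (simp add: *)
qed

section \<open>From the functional equation to the vanishing of \<open>R\<close>\<close>

lemma forest_equation_root:
  fixes x y :: "'a::{idom,ring_char_0}" and F :: "'a poly fps" and f :: "'a fps"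
  defines "U \<equiv> fps_const (monom 1 1)" and "X \<equiv> fps_const [:x:]" and "Y \<equiv> fps_const [:y:]"
  assumes eq: "U * (F - 1) = fps_X * ((Y * U ^ 2 * F + (1 + X) * (U * (F - 1)) + X * (F - 1 - U * embed f)) * F)"
    and "x \<noteq> 0" "y \<noteq> 0"
  shows "R (fps_const x + fps_const x * f) fps_X (fps_const x) (fps_const y) = 0"
proof -
  \<comment> \<open>\<open>V\<close> absorbs the unknown \<open>f\<close> and is the series to be
    substituted for \<open>v\<close> in \<open>R\<close>.\<close>
  define V where "V = X + X * embed f"
  define A where "A = X + (1 + X) * U + Y * U ^ 2"
  define c where "c = 1 + fps_X + fps_X * V"
  define a where "a = fps_X * X + U * c"
  \<comment> \<open>The derivative in \<open>F\<close> of the quadratic polynomial in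
    \<open>quad\<close>; on a root its square is the discriminant.\<close>
  define G where "G = 2 * fps_X * A * F - a"
  define p\<^sub>3 where "p\<^sub>3 = - 4 * fps_X * Y"
  define p\<^sub>2 where "p\<^sub>2 = c ^ 2 - 4 * fps_X * (1 + X)"
  define p\<^sub>1 where "p\<^sub>1 = 2 * fps_X * X * (c - 2)"
  define p\<^sub>0 where "p\<^sub>0 = (fps_X * X) ^ 2"
  define D where "D = p\<^sub>3 * U ^ 3 + p\<^sub>2 * U ^ 2 + p\<^sub>1 * U + p\<^sub>0"
  define D' where "D' = 3 * p\<^sub>3 * U ^ 2 + 2 * p\<^sub>2 * U + p\<^sub>1"
  have quad: "fps_X * A * F ^ 2 - a * F + U = 0"
    using eq unfolding a_def c_def V_def A_def by algebra
  have D: "D = G ^ 2"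
  proof -
    have "D = a ^ 2 - 4 * fps_X * A * U"
      unfolding D_def p\<^sub>3_def p\<^sub>2_def p\<^sub>1_def p\<^sub>0_def a_def A_def by algebra
    also have "\<dots> = G ^ 2" using quad unfolding G_def by algebra
    finally show ?thesis .
  qed
  define k where "k = 1 + fps_X + fps_X * (fps_const x + fps_const x * f)"
  have emb: "X = embed (fps_const x)" "Y = embed (fps_const y)" "c = embed k"
    by (simp_all add: X_def Y_def c_def V_def k_def)
  \<comment> \<open>In this form the coefficients are visibly free of \<open>U\<close>, so
    differentiating \<open>D\<close> yields \<open>D'\<close>.\<close>
  have "p\<^sub>3 = embed (- 4 * fps_X * fps_const y)" "p\<^sub>2 = embed (k ^ 2 - 4 * fps_X * (1 + fps_const x))"
    "p\<^sub>1 = embed (2 * fps_X * fps_const x * (k - 2))" "p\<^sub>0 = embed ((fps_X * fps_const x) ^ 2)"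
    unfolding p\<^sub>3_def p\<^sub>2_def p\<^sub>1_def p\<^sub>0_def emb by simp_all
  then have p': "pderiv_fps p\<^sub>3 = 0" "pderiv_fps p\<^sub>2 = 0" "pderiv_fps p\<^sub>1 = 0" "pderiv_fps p\<^sub>0 = 0"
    by (simp_all only: pderiv_fps_embed)
  have "pderiv_fps U = 1" by (auto simp: fps_eq_iff U_def pderiv_monom monom_0 one_pCons)
  then have "pderiv_fps D = D'"
    unfolding D_def D'_def by (simp add: p' power2_eq_square power3_eq_cube algebra_simps)
  moreover have "pderiv_fps D = 2 * G * pderiv_fps G"
    unfolding D by (simp add: power2_eq_square algebra_simps)
  ultimately have dvd: "G dvd D" "G dvd D'" unfolding D by (simp_all add: power2_eq_square)
  have "embed (- 576 * fps_X ^ 4 * fps_const x ^ 2 * fps_const y * R (fps_const x + fps_const x * f) fps_X (fps_const x) (fps_const y))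
    = - 576 * fps_X ^ 4 * X ^ 2 * Y * R V fps_X X Y"
    unfolding embed_mult embed_R embed_add embed_minus embed_power embed_numeral embed_X embed_const
    by (simp only: X_def Y_def V_def)
  also have "\<dots> = - 9 * p\<^sub>3 * (18 * p\<^sub>3 * p\<^sub>2 * p\<^sub>1 * p\<^sub>0 - 4 * p\<^sub>2 ^ 3 * p\<^sub>0 + p\<^sub>2 ^ 2 * p\<^sub>1 ^ 2 - 4 * p\<^sub>3 * p\<^sub>1 ^ 3 - 27 * p\<^sub>3 ^ 2 * p\<^sub>0 ^ 2)"
    unfolding p\<^sub>3_def p\<^sub>2_def p\<^sub>1_def p\<^sub>0_def c_def by (rule discriminant_R[symmetric])
  also have "G dvd \<dots>"
    unfolding cubic_discriminant_combination[of p\<^sub>3 p\<^sub>2 p\<^sub>1 p\<^sub>0 U] D_def[symmetric] D'_def[symmetric]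
    by (intro dvd_diff dvd_mult dvd)
  finally have "- 576 * fps_X ^ 4 * fps_const x ^ 2 * fps_const y * R (fps_const x + fps_const x * f) fps_X (fps_const x) (fps_const y) = 0"
    \<comment> \<open>At order 0 in the series variable, \<open>a\<close> reduces to
      \<open>U\<close>, hence \<open>G\<close> to \<open>- U\<close>.\<close>
    by (rule embed_multiple_eq_0) (simp add: G_def a_def c_def U_def)
  \<comment> \<open>Characteristic 0 and nonzero \<open>x\<close>, \<open>y\<close> allow the
    monomial factor to be cancelled.\<close>
  moreover have "(- 576 :: 'a fps) \<noteq> 0" by (simp add: numeral_fps_const)
  ultimately show ?thesis using \<open>x \<noteq> 0\<close> \<open>y \<noteq> 0\<close> by simp
qed

text \<open>Translates a recurrence for the coefficients into the functional equation. The
  recurrence is multiplied by the catalytic variable so that \<open>\<psi>\<close> is expressed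
  through \<open>\<phi>\<close> without a division by it.\<close>

lemma forest_series_root:
  fixes x y :: "'a::{idom,ring_char_0}" and \<phi> :: "nat \<Rightarrow> 'a poly"
  defines "\<psi> \<equiv> (\<lambda>n. monom y 2 * \<phi> n + smult (1 + x) (monom 1 1 * (\<phi> n - [:coeff (\<phi> n) 0:]))
    + smult x (\<phi> n - [:coeff (\<phi> n) 0:] - monom (coeff (\<phi> n) 1) 1))"
  assumes \<phi>0: "\<phi> 0 = 1" and coeff0: "\<And>n. coeff (\<phi> (Suc n)) 0 = 0"
    and rec: "\<And>n. monom 1 1 * \<phi> (Suc n) = (\<Sum>b\<le>n. \<psi> b * \<phi> (n - b))"
    and "x \<noteq> 0" "y \<noteq> 0"
  shows "R (fps_const x + fps_const x * Abs_fps (\<lambda>n. coeff (\<phi> n) 1)) fps_X (fps_const x) (fps_const y) = 0"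
proof (rule forest_equation_root[OF _ \<open>x \<noteq> 0\<close> \<open>y \<noteq> 0\<close>])
  define F where "F = Abs_fps \<phi>"
  define f where "f = Abs_fps (\<lambda>n. coeff (\<phi> n) 1)"
  define U where "U = fps_const (monom 1 1 :: 'a poly)"
  define \<Psi> where "\<Psi> = fps_const [:y:] * U ^ 2 * F + (1 + fps_const [:x:]) * (U * (F - 1)) + fps_const [:x:] * (F - 1 - U * embed f)"
  \<comment> \<open>Only \<open>\<phi> 0 = 1\<close> has a constant term, so dropping constant terms
    amounts to subtracting 1 from \<open>F\<close>.\<close>
  have F1: "(F - 1) $ n = \<phi> n - [:coeff (\<phi> n) 0:]" for n
    using \<phi>0 coeff0 by (cases n) (simp_all add: F_def one_pCons)
  have \<Psi>: "\<Psi> $ n = \<psi> n" for n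
  proof -
    have u: "monom 1 1 * [:c:] = monom c 1" for c :: 'a
      by (simp add: mult_monom flip: monom_0)
    have y: "[:y:] * monom 1 1 ^ 2 = monom y 2"
      by (simp add: monom_power smult_monom)
    have "\<Psi> = fps_const ([:y:] * monom 1 1 ^ 2) * F + fps_const (1 + [:x:]) * (U * (F - 1))
        + fps_const [:x:] * ((F - 1) - U * embed f)"
      by (simp add: \<Psi>_def U_def flip: fps_const_add)
    then have "\<Psi> $ n = [:y:] * monom 1 1 ^ 2 * F $ n + (1 + [:x:]) * (monom 1 1 * (F - 1) $ n)
        + [:x:] * ((F - 1) $ n - monom 1 1 * embed f $ n)"
      unfolding U_def by (simp only: fps_add_nth fps_sub_nth fps_mult_left_const_nth)
    also have "\<dots> = \<psi> n"
      unfolding F1 embed_nth f_def fps_nth_Abs_fps u y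
      by (simp add: \<psi>_def F_def smult_monom smult_add_left distrib_right)
    finally show ?thesis .
  qed
  have "U * (F - 1) = fps_X * (\<Psi> * F)"
  proof (rule fps_ext)
    fix n
    show "(U * (F - 1)) $ n = (fps_X * (\<Psi> * F)) $ n"
    proof (cases n)
      case 0
      then show ?thesis using \<phi>0 by (simp add: F_def)
    next
      case (Suc m)
      have "(fps_X * (\<Psi> * F)) $ n = (\<Psi> * F) $ m" by (simp add: Suc)
      also have "\<dots> = (\<Sum>b\<le>m. \<psi> b * \<phi> (m - b))"
        by (simp add: fps_mult_nth \<Psi> F_def atLeast0AtMost)
      also have "\<dots> = monom 1 1 * \<phi> n" using rec Suc by simp
      finally show ?thesis by (simp add: Suc U_def F_def)
    qed
  qed
  then show "fps_const (monom 1 1) * (F - 1) = fps_X * ((fps_const [:y:] * fps_const (monom 1 1) ^ 2 * F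
      + (1 + fps_const [:x:]) * (fps_const (monom 1 1) * (F - 1))
      + fps_const [:x:] * (F - 1 - fps_const (monom 1 1) * embed f)) * F)"
    unfolding \<Psi>_def U_def .
qed

section \<open>The recurrence\<close>

context
  fixes x y :: "'a::idom"
begin

text \<open>Using \<open>des p\<close> rather than \<open>des p + 1\<close> gives the empty word
  weight 1 and lets weights multiply over subtrees; the missing factor \<open>x\<close> returns in
  \<open>I_gf_eq\<close>.\<close>

definition word_weight :: "nat list \<Rightarrow> 'a" where
  "word_weight p = x ^ des p * y ^ nat (peak p + 1)"

definition forest_weight :: "nat list list \<Rightarrow> 'a poly" where
  "forest_weight ws = monom (\<Prod>w\<leftarrow>ws. word_weight w) (length ws)"

text \<open>The root is a leaf, marked by \<open>y\<close>, or starts a descent into its right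
  subtree, marked by \<open>x\<close>, or has only a left subtree.\<close>

definition root_weight :: "nat list \<Rightarrow> nat list \<Rightarrow> 'a" where
  "root_weight l r = (if r = [] then if l = [] then y else 1 else x)"

text \<open>The weight includes the deleted root: its tree counts as one word in the exponent,
  whence \<open>+ 1\<close>.\<close>

definition cut_weight :: "nat list list \<times> nat list \<times> nat list \<Rightarrow> 'a poly" where
  "cut_weight = (\<lambda>(ws, l, r). monom ((\<Prod>w\<leftarrow>ws. word_weight w) * word_weight l * word_weight r * root_weight l r)
     (length ws + 1))"

definition forest_sum :: "nat set \<Rightarrow> 'a poly" where
  "forest_sum S = (\<Sum>ws\<in>forests S. forest_weight ws)"

definition cut_sum :: "nat set \<Rightarrow> 'a poly" where
  "cut_sum S = (\<Sum>t\<in>cuts S. cut_weight t)"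

lemma word_weight_Nil [simp]: "word_weight [] = 1"
  by (simp add: word_weight_def)

lemma word_weight_max:
  assumes "\<forall>a\<in>set l \<union> set r. a < m"
  shows "word_weight (l @ m # r) = word_weight l * word_weight r * root_weight l r"
proof -
  have "nat (peak (l @ m # r) + 1) = nat (peak l + 1) + nat (peak r + 1) + of_bool (l = [] \<and> r = [])"
    using peak_max[OF assms] peak_ge[of l] peak_ge[of r] by auto
  then show ?thesis
    by (simp add: word_weight_def root_weight_def des_max[OF assms] power_add mult_ac)
qed

lemma forest_weight_max:
  assumes "\<forall>a\<in>set l \<union> set r. a < m"
  shows "forest_weight (ws @ (l @ m # r) # vs) = cut_weight (ws, l, r) * forest_weight vs"
  by (simp add: forest_weight_def cut_weight_def word_weight_max[OF assms] mult_monom mult_ac add_ac)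

section \<open>Sums over forests and cuts\<close>

lemma forest_sum_empty: "forest_sum {} = 1"
proof -
  have "forests {} = {[]}"
  proof -
    have "ws = []" if "ws \<in> forests {}" for ws
      using that by (cases ws) (auto simp: forests_def arrangements_def)
    then show ?thesis by (auto simp: forests_def arrangements_def)
  qed
  then show ?thesis by (simp add: forest_sum_def forest_weight_def one_pCons monom_0)
qed

lemma forest_sum_length:
  assumes "finite S"
  shows "(\<Sum>ws\<in>{ws \<in> forests S. length ws = k}. forest_weight ws) = monom (coeff (forest_sum S) k) k"
proof -
  have "coeff (forest_sum S) k = (\<Sum>ws\<in>forests S. coeff (forest_weight ws) k)"
    by (simp add: forest_sum_def coeff_sum)
  also have "\<dots> = (\<Sum>ws\<in>{ws \<in> forests S. length ws = k}. (\<Prod>w\<leftarrow>ws. word_weight w))"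
    using finite_forests[OF assms] by (simp add: forest_weight_def sum.inter_filter if_distrib)
  finally show ?thesis by (simp add: monom_sum forest_weight_def)
qed

lemma last_forest_nonempty: "ws \<in> forests S \<Longrightarrow> ws \<noteq> [] \<Longrightarrow> last ws \<noteq> []"
  unfolding forests_def by (metis (no_types, lifting) last_in_set mem_Collect_eq)

text \<open>Emptiness of the two subtrees tells the four images in \<open>cuts_eq\<close> apart, and
  within each the forest can be reassembled from its cut.\<close>

lemma sum_cuts:
  assumes "finite S"
  shows "(\<Sum>t\<in>cuts S. f t) = (\<Sum>ws\<in>forests S. f (ws, [], []) :: 'b::comm_monoid_add)
    + (\<Sum>ws\<in>{ws \<in> forests S. ws \<noteq> []}. f (butlast ws, last ws, []))
    + (\<Sum>ws\<in>{ws \<in> forests S. ws \<noteq> []}. f (butlast ws, [], last ws))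
    + (\<Sum>ws\<in>{ws \<in> forests S. 2 \<le> length ws}. f (butlast (butlast ws), last (butlast ws), last ws))"
    (is "_ = ?a + ?b + ?c + ?d")
proof -
  define A where "A = (\<lambda>ws. (ws, [] :: nat list, [] :: nat list)) ` forests S"
  define B where "B = (\<lambda>ws. (butlast ws, last ws, [] :: nat list)) ` {ws \<in> forests S. ws \<noteq> []}"
  define C where "C = (\<lambda>ws. (butlast ws, [] :: nat list, last ws)) ` {ws \<in> forests S. ws \<noteq> []}"
  define D where "D = (\<lambda>ws. (butlast (butlast ws), last (butlast ws), last ws)) ` {ws \<in> forests S. 2 \<le> length ws}"
  have last2: "last (butlast ws) \<noteq> [] \<and> last ws \<noteq> []" if *: "ws \<in> forests S" "2 \<le> length ws" for ws
  proof -
    obtain us l r where ws: "ws = us @ [l, r]"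
      by (rule that[OF append_butlast_last2[OF *(2), symmetric]])
    then show ?thesis using *(1) by (auto simp: forests_def butlast_append)
  qed
  have sub: "A \<subseteq> {(ws, l, r). l = [] \<and> r = []}" "B \<subseteq> {(ws, l, r). l \<noteq> [] \<and> r = []}"
      "C \<subseteq> {(ws, l, r). l = [] \<and> r \<noteq> []}" "D \<subseteq> {(ws, l, r). l \<noteq> [] \<and> r \<noteq> []}"
    using last_forest_nonempty last2 by (auto simp: A_def B_def C_def D_def)
  have disj: "A \<inter> B = {}" "(A \<union> B) \<inter> C = {}" "(A \<union> B \<union> C) \<inter> D = {}"
    using sub by fastforce+
  have fin: "finite A" "finite B" "finite C" "finite D"
    using finite_forests[OF assms] by (auto simp: A_def B_def C_def D_def)
  have "cuts S = A \<union> B \<union> C \<union> D"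
    unfolding cuts_eq A_def B_def C_def D_def ..
  then have "(\<Sum>t\<in>cuts S. f t) = sum f A + sum f B + sum f C + sum f D"
    using fin disj by (simp add: sum.union_disjoint)
  moreover have "sum f A = ?a" unfolding A_def
    by (subst sum.reindex) (auto intro: inj_onI)
  moreover have "sum f B = ?b" unfolding B_def
  proof (subst sum.reindex)
    show "inj_on (\<lambda>ws. (butlast ws, last ws, [] :: nat list)) {ws \<in> forests S. ws \<noteq> []}"
      by (rule inj_onI, rule butlast_last_inject) simp_all
  qed simp
  moreover have "sum f C = ?c" unfolding C_def
  proof (subst sum.reindex)
    show "inj_on (\<lambda>ws. (butlast ws, [] :: nat list, last ws)) {ws \<in> forests S. ws \<noteq> []}"
      by (rule inj_onI, rule butlast_last_inject) simp_all
  qed simp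
  moreover have "sum f D = ?d" unfolding D_def
  proof (subst sum.reindex)
    show "inj_on (\<lambda>ws. (butlast (butlast ws), last (butlast ws), last ws)) {ws \<in> forests S. 2 \<le> length ws}"
    proof (rule inj_onI)
      fix us vs
      assume *: "us \<in> {ws \<in> forests S. 2 \<le> length ws}" "vs \<in> {ws \<in> forests S. 2 \<le> length ws}"
        "(butlast (butlast us), last (butlast us), last us) = (butlast (butlast vs), last (butlast vs), last vs)"
      have "us = butlast (butlast us) @ [last (butlast us), last us]"
        using *(1) by (simp only: append_butlast_last2 mem_Collect_eq)
      also have "\<dots> = butlast (butlast vs) @ [last (butlast vs), last vs]"
        using *(3) by (simp only: prod.inject)
      also have "\<dots> = vs"
        using *(2) by (simp only: append_butlast_last2 mem_Collect_eq)
      finally show "us = vs" .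
    qed
  qed simp
  ultimately show ?thesis by simp
qed

lemma sum_forests_nonempty:
  assumes "finite S"
  shows "(\<Sum>ws\<in>{ws \<in> forests S. ws \<noteq> []}. forest_weight ws) = forest_sum S - [:coeff (forest_sum S) 0:]"
proof -
  have "forest_sum S = (\<Sum>ws\<in>{ws \<in> forests S. ws \<noteq> []} \<union> {ws \<in> forests S. length ws = 0}. forest_weight ws)"
    unfolding forest_sum_def by (rule sum.cong) auto
  also have "\<dots> = (\<Sum>ws\<in>{ws \<in> forests S. ws \<noteq> []}. forest_weight ws) + [:coeff (forest_sum S) 0:]"
    using finite_forests[OF assms] forest_sum_length[OF assms, of 0]
    by (subst sum.union_disjoint) (auto simp: monom_0)
  finally show ?thesis by (rule eq_diff_eq[THEN iffD2, OF sym])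
qed

lemma sum_forests_ge2:
  assumes "finite S"
  shows "(\<Sum>ws\<in>{ws \<in> forests S. 2 \<le> length ws}. forest_weight ws)
    = forest_sum S - [:coeff (forest_sum S) 0:] - monom (coeff (forest_sum S) 1) 1"
proof -
  have "{ws \<in> forests S. ws \<noteq> []} = {ws \<in> forests S. 2 \<le> length ws} \<union> {ws \<in> forests S. length ws = 1}"
  proof -
    have "ws \<noteq> [] \<longleftrightarrow> 2 \<le> length ws \<or> length ws = 1" for ws :: "nat list list"
      by (cases ws) (auto simp: Suc_le_eq)
    then show ?thesis by blast
  qed
  then have "(\<Sum>ws\<in>{ws \<in> forests S. ws \<noteq> []}. forest_weight ws)
    = (\<Sum>ws\<in>{ws \<in> forests S. 2 \<le> length ws} \<union> {ws \<in> forests S. length ws = 1}. forest_weight ws)"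
    by simp
  also have "\<dots> = (\<Sum>ws\<in>{ws \<in> forests S. 2 \<le> length ws}. forest_weight ws) + monom (coeff (forest_sum S) 1) 1"
    using finite_forests[OF assms] forest_sum_length[OF assms, of 1]
    by (subst sum.union_disjoint) auto
  finally show ?thesis unfolding sum_forests_nonempty[OF assms] by (rule eq_diff_eq[THEN iffD2, OF sym])
qed

text \<open>A root without subtrees contributes \<open>y\<close>, with a left one only 1, with a
  right one \<open>x\<close>. A cut with two subtrees has exponent one below that of the forest it
  comes from, which the factor \<open>monom 1 1\<close> compensates.\<close>

lemma cut_sum:
  assumes "finite S"
  shows "monom 1 1 * cut_sum S = monom y 2 * forest_sum S
    + smult (1 + x) (monom 1 1 * (forest_sum S - [:coeff (forest_sum S) 0:]))
    + smult x (forest_sum S - [:coeff (forest_sum S) 0:] - monom (coeff (forest_sum S) 1) 1)"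
proof -
  have 1: "monom 1 1 * cut_weight (ws, [], []) = monom y 2 * forest_weight ws" for ws
    by (simp add: cut_weight_def root_weight_def forest_weight_def mult_monom mult_ac numeral_2_eq_2)
  have snoc: "\<exists>us w. ws = us @ [w] \<and> w \<noteq> []" if "ws \<in> {ws \<in> forests S. ws \<noteq> []}" for ws
  proof (intro exI conjI)
    show "ws = butlast ws @ [last ws]" using that by simp
    show "last ws \<noteq> []" using that last_forest_nonempty by blast
  qed
  have 2: "monom 1 1 * cut_weight (butlast ws, last ws, []) = monom 1 1 * forest_weight ws"
    if "ws \<in> {ws \<in> forests S. ws \<noteq> []}" for ws
  proof -
    from snoc[OF that] obtain us w where "ws = us @ [w]" "w \<noteq> []" by blast
    then show ?thesis by (simp add: cut_weight_def root_weight_def forest_weight_def)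
  qed
  have 3: "monom 1 1 * cut_weight (butlast ws, [], last ws) = smult x (monom 1 1 * forest_weight ws)"
    if "ws \<in> {ws \<in> forests S. ws \<noteq> []}" for ws
  proof -
    from snoc[OF that] obtain us w where "ws = us @ [w]" "w \<noteq> []" by blast
    then show ?thesis
      by (simp add: cut_weight_def root_weight_def forest_weight_def smult_monom mult_monom mult_ac)
  qed
  have 4: "monom 1 1 * cut_weight (butlast (butlast ws), last (butlast ws), last ws) = smult x (forest_weight ws)"
    if "ws \<in> {ws \<in> forests S. 2 \<le> length ws}" for ws
  proof -
    define us l r where "us = butlast (butlast ws)" and "l = last (butlast ws)" and "r = last ws"
    have ws: "ws = us @ [l, r]" using append_butlast_last2[of ws] that by (simp add: us_def l_def r_def)
    have "r \<noteq> []" using that ws by (auto simp: forests_def)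
    then have "monom 1 1 * cut_weight (us, l, r) = smult x (forest_weight ws)"
      unfolding ws by (simp add: cut_weight_def root_weight_def forest_weight_def smult_monom mult_monom mult_ac)
    then show ?thesis by (simp add: us_def l_def r_def)
  qed
  have "monom 1 1 * cut_sum S = (\<Sum>t\<in>cuts S. monom 1 1 * cut_weight t)"
    by (simp add: cut_sum_def sum_distrib_left)
  also have "\<dots> = (\<Sum>ws\<in>forests S. monom y 2 * forest_weight ws)
    + (\<Sum>ws\<in>{ws \<in> forests S. ws \<noteq> []}. monom 1 1 * forest_weight ws)
    + (\<Sum>ws\<in>{ws \<in> forests S. ws \<noteq> []}. smult x (monom 1 1 * forest_weight ws))
    + (\<Sum>ws\<in>{ws \<in> forests S. 2 \<le> length ws}. smult x (forest_weight ws))"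
    unfolding sum_cuts[OF assms] by (intro arg_cong2[where f = plus] sum.cong refl 1 2 3 4)
  also have "\<dots> = monom y 2 * forest_sum S
    + monom 1 1 * (\<Sum>ws\<in>{ws \<in> forests S. ws \<noteq> []}. forest_weight ws)
    + smult x (monom 1 1 * (\<Sum>ws\<in>{ws \<in> forests S. ws \<noteq> []}. forest_weight ws))
    + smult x (\<Sum>ws\<in>{ws \<in> forests S. 2 \<le> length ws}. forest_weight ws)"
    by (simp only: forest_sum_def sum_distrib_left smult_sum_right)
  finally show ?thesis
    unfolding sum_forests_nonempty[OF assms] sum_forests_ge2[OF assms]
    by (simp add: smult_add_left algebra_simps)
qed

text \<open>Reinserting the maximum via \<open>h\<close> is a bijection by
  \<open>arrangements_max\<close>, where \<open>b\<close> is the number of entries in the cut. The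
  left end \<open>a\<close> is arbitrary because the later trees occupy an interval starting at
  \<open>a + b\<close>.\<close>

lemma forest_sum_Suc:
  "forest_sum {a..<a + Suc n} = (\<Sum>b\<le>n. cut_sum {a..<a + b} * forest_sum {a + b..<a + n})"
proof -
  define T where "T = Sigma {..n} (\<lambda>b. cuts {a..<a + b} \<times> forests {a + b..<a + n})"
  define h where "h = (\<lambda>(b :: nat, (ws, l, r), vs). ws @ (l @ (a + n) # r) # vs)"
  have T: "b \<le> n" "set (concat ws) \<union> set l \<union> set r = {a..<a + b}"
    "a + n \<notin> set (concat ws)" "a + n \<notin> set l" "a + n \<notin> set r"
    if "(b, (ws, l, r), vs) \<in> T" for b ws l r vs
  proof -
    show b: "b \<le> n" using that by (simp add: T_def)
    have "set (concat (ws @ [l, r])) = {a..<a + b}"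
      using that unfolding T_def cuts_def arrangements_def by blast
    then show eq: "set (concat ws) \<union> set l \<union> set r = {a..<a + b}" by auto
    have "a + n \<notin> set (concat ws) \<union> set l \<union> set r" unfolding eq using b by simp
    then show "a + n \<notin> set (concat ws)" "a + n \<notin> set l" "a + n \<notin> set r" by blast+
  qed
  have inj: "inj_on h T"
  proof (rule inj_onI)
    fix s t assume st: "s \<in> T" "t \<in> T" "h s = h t"
    obtain b ws l r vs where s: "s = (b, (ws, l, r), vs)" by (metis prod.exhaust)
    obtain b' ws' l' r' vs' where t: "t = (b', (ws', l', r'), vs')" by (metis prod.exhaust)
    note Ts = T[OF st(1)[unfolded s]] and Tt = T[OF st(2)[unfolded t]]
    \<comment> \<open>The maximum occurs in no word of \<open>ws\<close>, so its position in the
      forest recovers \<open>ws\<close>.\<close>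
    have tw: "takeWhile (\<lambda>w. a + n \<notin> set w) (ws @ (l @ (a + n) # r) # vs) = ws"
      if "a + n \<notin> set (concat ws)" for ws l r vs
    proof -
      have "a + n \<notin> set w" if "w \<in> set ws" for w
        using that \<open>a + n \<notin> set (concat ws)\<close> by auto
      then have "takeWhile (\<lambda>w. a + n \<notin> set w) (ws @ us) = ws @ takeWhile (\<lambda>w. a + n \<notin> set w) us" for us
        by (rule takeWhile_append2)
      then show ?thesis by simp
    qed
    have eq: "ws @ (l @ (a + n) # r) # vs = ws' @ (l' @ (a + n) # r') # vs'"
      using st(3) by (simp add: s t h_def)
    have 1: "ws = ws'"
      by (rule trans[OF tw[OF Ts(3), of l r vs, unfolded eq, symmetric] tw[OF Tt(3)]])
    then have 2: "l @ (a + n) # r = l' @ (a + n) # r'" "vs = vs'" using eq by auto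
    have 3: "l = l'" "r = r'"
      using 2(1) append_Cons_eq_iff[of "a + n" l r l' r'] Ts(4,5) by blast+
    \<comment> \<open>The size \<open>b\<close> is recoverable from the entries of
      \<open>ws\<close>, \<open>l\<close> and \<open>r\<close>.\<close>
    have "{a..<a + b} = {a..<a + b'}" using Ts(2) Tt(2) 1 3 by simp
    then have "card {a..<a + b} = card {a..<a + b'}" by (rule arg_cong)
    then have "b = b'" by simp
    then show "s = t" using 1 2 3 s t by simp
  qed
  have img: "h ` T = forests {a..<a + Suc n}"
  proof (intro equalityI subsetI)
    fix us assume "us \<in> h ` T"
    then obtain b ws l r vs where "(b, (ws, l, r), vs) \<in> T" "us = ws @ (l @ (a + n) # r) # vs"
      by (auto simp: h_def)
    then show "us \<in> forests {a..<a + Suc n}"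
      unfolding forests_def mem_Collect_eq using arrangements_max[of ws l a n r vs]
      by (auto simp: T_def cuts_def forests_def)
  next
    fix us assume us: "us \<in> forests {a..<a + Suc n}"
    then have "a + n \<in> set (concat us)" by (auto simp: forests_def arrangements_def)
    then obtain w where w: "w \<in> set us" "a + n \<in> set w" by auto
    obtain ws vs where us': "us = ws @ w # vs" using w(1) by (metis split_list)
    obtain l r where w': "w = l @ (a + n) # r" using w(2) by (metis split_list)
    have "ws @ (l @ (a + n) # r) # vs \<in> arrangements {a..<a + Suc n}" "[] \<notin> set ws" "[] \<notin> set vs"
      using us us' w' by (auto simp: forests_def)
    then obtain b where "b \<le> n" "ws @ [l, r] \<in> arrangements {a..<a + b}"
      "vs \<in> arrangements {a + b..<a + n}" "[] \<notin> set ws" "[] \<notin> set vs"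
      using arrangements_max[of ws l a n r vs] by blast
    then have "(b, (ws, l, r), vs) \<in> T" by (auto simp: T_def cuts_def forests_def)
    moreover have "us = h (b, (ws, l, r), vs)" by (simp add: h_def us' w')
    ultimately show "us \<in> h ` T" by blast
  qed
  have fin: "finite (cuts {a..<a + b})" for b
    unfolding cuts_eq using finite_forests[of "{a..<a + b}"] by auto
  have "forest_sum {a..<a + Suc n} = (\<Sum>t\<in>T. forest_weight (h t))"
    unfolding forest_sum_def img[symmetric] by (subst sum.reindex[OF inj]) simp
  also have "\<dots> = (\<Sum>(b, t, vs)\<in>T. cut_weight t * forest_weight vs)"
  proof (rule sum.cong[OF refl])
    fix t assume t: "t \<in> T"
    obtain b ws l r vs where s: "t = (b, (ws, l, r), vs)" by (metis prod.exhaust)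
    have "set l \<union> set r \<subseteq> {a..<a + b}" "b \<le> n" using T(1,2)[OF t[unfolded s]] by blast+
    then have "\<forall>i\<in>set l \<union> set r. i < a + n" by auto
    then show "forest_weight (h t) = (case t of (b, t, vs) \<Rightarrow> cut_weight t * forest_weight vs)"
      by (simp add: s h_def forest_weight_max)
  qed
  also have "\<dots> = (\<Sum>b\<le>n. \<Sum>(t, vs)\<in>cuts {a..<a + b} \<times> forests {a + b..<a + n}. cut_weight t * forest_weight vs)"
    unfolding T_def by (subst sum.Sigma) (auto simp: fin finite_forests)
  also have "\<dots> = (\<Sum>b\<le>n. cut_sum {a..<a + b} * forest_sum {a + b..<a + n})"
    by (simp add: cut_sum_def forest_sum_def sum_product sum.cartesian_product)
  finally show ?thesis .
qed

text \<open>The recurrence depends only on the sizes of the intervals, so induction on the size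
  replaces a relabelling of forests.\<close>

lemma forest_sum_shift: "forest_sum {a..<a + n} = forest_sum {1..<1 + n}"
proof (induction n arbitrary: a rule: less_induct)
  case (less n)
  show ?case
  proof (cases n)
    case 0
    then show ?thesis by simp
  next
    case (Suc k)
    have F: "forest_sum {c..<c + b} = forest_sum {1..<1 + b}" if "b \<le> k" for b c
      using less Suc that by simp
    have C: "cut_sum {c..<c + b} = cut_sum {1..<1 + b}" if "b \<le> k" for b c
    proof -
      \<comment> \<open>Up to the factor \<open>monom 1 1\<close>, which cancels in a domain, cut
        sums are functions of forest sums.\<close>
      have "monom 1 1 * cut_sum {c..<c + b} = monom 1 1 * cut_sum {1..<1 + b}"
        by (rule trans[OF cut_sum[OF finite_atLeastLessThan, of c "c + b", unfolded F[OF that, of c]]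
            cut_sum[OF finite_atLeastLessThan, symmetric]])
      then show ?thesis by (simp add: monom_eq_0_iff)
    qed
    have "cut_sum {a..<a + b} * forest_sum {a + b..<a + k} = cut_sum {1..<1 + b} * forest_sum {1 + b..<1 + k}"
      if "b \<le> k" for b
    proof -
      have e: "a + b + (k - b) = a + k" "1 + b + (k - b) = 1 + k" using that by simp_all
      have "forest_sum {a + b..<a + k} = forest_sum {1 + b..<1 + k}"
        using F[of "k - b" "a + b"] F[of "k - b" "1 + b"] unfolding e by (simp only: diff_le_self)
      then show ?thesis using C[OF that, of a] by (simp only:)
    qed
    then show ?thesis unfolding Suc forest_sum_Suc by (intro sum.cong) auto
  qed
qed

lemma coeff_forest_sum_1:
  assumes "n > 0"
  shows "coeff (forest_sum {1..<1 + n}) 1 = (\<Sum>p\<in>W 2 n. word_weight p)"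
proof -
  have "monom (coeff (forest_sum {1..<1 + n}) 1) 1 =
      (\<Sum>ws\<in>{ws \<in> forests {1..<1 + n}. length ws = 1}. forest_weight ws)"
    by (simp add: forest_sum_length)
  \<comment> \<open>For a single word the condition in \<open>arrangements\<close> is that two
    passes sort it; \<open>n > 0\<close> ensures that the word is nonempty.\<close>
  also have "{ws \<in> forests {1..<1 + n}. length ws = 1} = (\<lambda>p. [p]) ` W 2 n"
  proof -
    have "{1..<1 + n} = {1..n}" by auto
    then show ?thesis using assms
      by (auto simp: forests_def arrangements_def W_def stack_sortable_def permutations_of_set_def
          length_Suc_conv numeral_2_eq_2)
  qed
  also have "(\<Sum>ws\<in>(\<lambda>p. [p]) ` W 2 n. forest_weight ws) = (\<Sum>p\<in>W 2 n. monom (word_weight p) 1)"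
    by (subst sum.reindex) (auto simp: inj_on_def forest_weight_def)
  also have "\<dots> = monom (\<Sum>p\<in>W 2 n. word_weight p) 1"
    by (simp add: monom_sum)
  finally show ?thesis by simp
qed

lemma coeff_forest_sum_0:
  assumes "finite S" "S \<noteq> {}"
  shows "coeff (forest_sum S) 0 = 0"
proof -
  have "{ws \<in> forests S. length ws = 0} = {}"
    using assms(2) by (auto simp: forests_def arrangements_def)
  then have "monom (coeff (forest_sum S) 0) 0 = 0"
    using forest_sum_length[OF assms(1), of 0] by (simp only: sum.empty)
  then show ?thesis by (simp add: monom_eq_0_iff)
qed

text \<open>The empty permutation contributes the separate term \<open>x\<close>: it is not a word
  of a forest, so the series on the right has coefficient 0 at \<open>n = 0\<close>.\<close>

lemma I_gf_eq:
  "I_gf x y = fps_const x + fps_const x * Abs_fps (\<lambda>n. coeff (forest_sum {1..<1 + n}) 1)"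
proof (rule fps_ext)
  fix n
  show "I_gf x y $ n = (fps_const x + fps_const x * Abs_fps (\<lambda>n. coeff (forest_sum {1..<1 + n}) 1)) $ n"
  proof (cases "n = 0")
    case True
    have "W 2 0 = {[]}" by (auto simp: W_def stack_sortable_def numeral_2_eq_2)
    then show ?thesis using True by (simp add: I_gf_def forest_sum_empty)
  next
    case False
    then show ?thesis
      using coeff_forest_sum_1[of n] by (simp add: I_gf_def word_weight_def sum_distrib_left mult_ac)
  qed
qed

end

section \<open>The algebraic equation for the generating function\<close>

lemma R_I_gf:
  fixes x y :: "'a::{idom,ring_char_0}"
  assumes "x \<noteq> 0" "y \<noteq> 0"
  shows "R (I_gf x y) fps_X (fps_const x) (fps_const y) = 0"
  unfolding I_gf_eq
proof (rule forest_series_root[OF _ _ _ assms])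
  show "forest_sum x y {1..<1 + 0} = 1" using forest_sum_empty by simp
next
  show "coeff (forest_sum x y {1..<1 + Suc n}) 0 = 0" for n
    by (rule coeff_forest_sum_0) auto
next
  fix n :: nat
  have "monom 1 1 * forest_sum x y {1..<1 + Suc n} =
      (\<Sum>b\<le>n. monom 1 1 * cut_sum x y {1..<1 + b} * forest_sum x y {1 + b..<1 + n})"
    unfolding forest_sum_Suc by (simp only: sum_distrib_left mult.assoc)
  \<comment> \<open>Shifting the second interval back to 1 turns the sum into a Cauchy
    product.\<close>
  also have "\<dots> = (\<Sum>b\<le>n. monom 1 1 * cut_sum x y {1..<1 + b} * forest_sum x y {1..<1 + (n - b)})"
  proof (rule sum.cong[OF refl])
    fix b assume "b \<in> {..n}"
    then have "1 + b + (n - b) = 1 + n" by simp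
    then have "forest_sum x y {1 + b..<1 + n} = forest_sum x y {1..<1 + (n - b)}"
      using forest_sum_shift[of x y "1 + b" "n - b"] by (simp only:)
    then show "monom 1 1 * cut_sum x y {1..<1 + b} * forest_sum x y {1 + b..<1 + n} =
        monom 1 1 * cut_sum x y {1..<1 + b} * forest_sum x y {1..<1 + (n - b)}" by (simp only:)
  qed
  finally show "monom 1 1 * forest_sum x y {1..<1 + Suc n} =
    (\<Sum>b\<le>n. (monom y 2 * forest_sum x y {1..<1 + b}
      + smult (1 + x) (monom 1 1 * (forest_sum x y {1..<1 + b} - [:coeff (forest_sum x y {1..<1 + b}) 0:]))
      + smult x (forest_sum x y {1..<1 + b} - [:coeff (forest_sum x y {1..<1 + b}) 0:]
        - monom (coeff (forest_sum x y {1..<1 + b}) 1) 1)) * forest_sum x y {1..<1 + (n - b)})"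
    unfolding cut_sum[OF finite_atLeastLessThan] .
qed

theorem theorem7:
  "R (I_gf X_var Y_var) fps_X (fps_const X_var) (fps_const Y_var) = 0"
  \<comment> \<open>The ring \<open>int poly poly\<close> is a domain of characteristic 0 in which
    both indeterminates are nonzero.\<close>
  by (rule R_I_gf) (simp_all add: X_var_def Y_var_def)

end
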